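(* Let $q$ be a prime power, $n$ a positive integer, and $r,k$ positive integers with $r\le k-r$. Let $S$ be a $(k-r)$-dimensional $\mathbb{F}_q$-subspace of $\mathbb{F}_{q^n}$ and $T$ an $r$-dimensional $\mathbb{F}_q$-subspace of $\mathbb{F}_{q^n}$ with $T=\langle a_1,\ldots,a_r\rangle_{\mathbb{F}_q}$ for some $a_1,\ldots,a_r\in\mathbb{F}_{q^n}$, and let $U=S\times T$. Then the set of points of weight $r$ in $L_U$ different from $\langle(1,0)\rangle_{\mathbb{F}_{q^n}}$ is $$\{\langle(\xi,1)\rangle_{\mathbb{F}_{q^n}}: \xi\in a_1^{-1}S\cap\cdots\cap a_r^{-1}S\},$$ and its size is $q^j$ where $j=\dim_{\mathbb{F}_q}(a_1^{-1}S\cap\cdots\cap a_r^{-1}S)$.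
   Context: For an $\mathbb{F}_q$-subspace $U\neq\{0\}$ of $\mathbb{F}_{q^n}^2$, the $\mathbb{F}_q$-linear set is $L_U=\{\langle u\rangle_{\mathbb{F}_{q^n}}: u\in U\setminus\{0\}\}\subseteq\mathrm{PG}(1,q^n)$, and the weight of a point $P=\langle v\rangle_{\mathbb{F}_{q^n}}$ in $L_U$ is $w_{L_U}(P)=\dim_{\mathbb{F}_q}(U\cap\langle v\rangle_{\mathbb{F}_{q^n}})$. For $S,T\subseteq\mathbb{F}_{q^n}$, $S\times T=\{(s,t):s\in S,t\in T\}$, and $aS=\{as:s\in S\}$. *)

theory Defs
  imports "HOL-Library.Cardinality" "HOL-Analysis.Product_Vector" "HOL-Number_Theory.Prime_Powers"
begin

text \<open>
  The extension of finite fields is an embedding \<open>emb\<close> of the small field \<open>'k\<close> (of order \<open>q\<close>) into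
  the large field \<open>'a\<close> (of order \<open>q ^ n\<close>). The \<open>'k\<close>-vector space structures on \<open>'a\<close> and on
  \<open>'a \<times> 'a\<close> are the ones induced by \<open>emb\<close>; subspaces, spans and dimensions are those of
  \<^theory>\<open>HOL.Vector_Spaces\<close>.
\<close>

locale field_embedding =
  fixes emb :: "'k::field \<Rightarrow> 'a::field"
  assumes emb_add: "emb (x + y) = emb x + emb y"
    and emb_mult: "emb (x * y) = emb x * emb y"
    and emb_one: "emb 1 = 1"

definition base_scale :: "('k::field \<Rightarrow> 'a::field) \<Rightarrow> 'k \<Rightarrow> 'a \<Rightarrow> 'a"
  where "base_scale emb c x = emb c * x"

definition base_scale2 :: "('k::field \<Rightarrow> 'a::field) \<Rightarrow> 'k \<Rightarrow> 'a \<times> 'a \<Rightarrow> 'a \<times> 'a"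
  where "base_scale2 emb = module_prod.scale (base_scale emb) (base_scale emb)"

lemma (in field_embedding) vector_space_base_scale: "vector_space (base_scale emb)"
  by unfold_locales (simp_all add: base_scale_def emb_add emb_mult emb_one algebra_simps)

lemma (in field_embedding) vector_space_base_scale2: "vector_space (base_scale2 emb)"
proof -
  interpret vector_space "base_scale emb" by (rule vector_space_base_scale)
  interpret vector_space_prod "base_scale emb" "base_scale emb" ..
  show ?thesis unfolding base_scale2_def by (rule p.vector_space_axioms)
qed

text \<open>A point of the projective line over \<open>'a\<close> is the one-dimensional \<open>'a\<close>-subspace of
  \<open>'a \<times> 'a\<close> spanned by a nonzero vector \<open>v\<close>.\<close>

definition proj_point :: "'a::field \<times> 'a \<Rightarrow> ('a \<times> 'a) set"
  where "proj_point v = module.span (module_prod.scale (*) (*)) {v}"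

definition linear_set :: "('a::field \<times> 'a) set \<Rightarrow> ('a \<times> 'a) set set"
  where "linear_set U = proj_point ` (U - {0})"

definition weight :: "('k::field \<Rightarrow> 'a::field) \<Rightarrow> ('a \<times> 'a) set \<Rightarrow> ('a \<times> 'a) set \<Rightarrow> nat"
  where "weight emb U P = vector_space.dim (base_scale2 emb) (U \<inter> P)"

end

(*
  A vector of U on the point <(xi,1)> has the form (t xi, t) with t in T and t xi in S, so the weight
  of the point is the dimension of {t in T. t xi in S}. It equals dim T exactly when xi T is contained
  in S, which can be tested on the generators a_1, ..., a_r. Dimensions are compared by counting
  vectors.
*)
theory Submission
  imports Defs
begin

section \<open>Counting vectors in finite-dimensional spaces\<close>

lemma (in vector_space) card_span_independent:
  assumes "finite B" and "independent B"
  shows "card (span B) = card (UNIV :: 'a set) ^ card B"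
  using assms
proof (induction B rule: finite_induct)
  case empty
  then show ?case by simp
next
  case (insert b B)
  have indep: "independent B" and b: "b \<notin> span B"
    using insert by (auto simp: independent_insert)
  \<comment> \<open>Splitting a vector into a multiple of \<open>b\<close> and a part in
    \<open>span B\<close> is unique, so \<open>?f\<close> is a bijection onto the larger span, and
    each new basis vector multiplies the count by the number of scalars.\<close>
  let ?f = "\<lambda>(c, x). scale c b + x"
  have "inj_on ?f (UNIV \<times> span B)"
  proof (rule inj_onI, clarify)
    fix c x d y
    assume x: "x \<in> span B" and y: "y \<in> span B" and eq: "scale c b + x = scale d b + y"
    have "scale (c - d) b = y - x"
      using eq by (simp add: scale_left_diff_distrib algebra_simps)
    then have *: "scale (c - d) b \<in> span B"
      using span_diff[OF y x] by simp
    have "c = d"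
    proof (rule ccontr)
      \<comment> \<open>Dividing by \<open>c - d\<close> would put \<open>b\<close> into
        \<open>span B\<close>, against independence.\<close>
      assume "c \<noteq> d"
      then show False
        using span_scale[OF *, of "inverse (c - d)"] b by simp
    qed
    then show "c = d \<and> x = y"
      using eq by simp
  qed
  moreover have "?f ` (UNIV \<times> span B) = span (insert b B)"
  proof -
    \<comment> \<open>The two inclusions, in the form that \<open>span_insert\<close> produces:
      \<open>z\<close> lies in the span of \<open>insert b B\<close> iff subtracting some multiple
      of \<open>b\<close> from \<open>z\<close> leaves a vector of \<open>span B\<close>.\<close>
    have "z \<in> ?f ` (UNIV \<times> span B)" if "z - scale c b \<in> span B" for z c
      using that by (intro image_eqI[of _ _ "(c, z - scale c b)"]) auto
    moreover have "\<exists>c'. scale c b + x - scale c' b \<in> span B" if "x \<in> span B" for c x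
      using that by (intro exI[of _ c]) simp
    ultimately show ?thesis
      by (auto simp: span_insert)
  qed
  ultimately have "card (span (insert b B)) = card ((UNIV :: 'a set) \<times> span B)"
    by (metis card_image)
  then show ?case
    using insert indep by (simp add: card_cartesian_product)
qed

lemma (in vector_space) card_subspace:
  assumes "subspace V" and "finite V"
  shows "card V = card (UNIV :: 'a set) ^ dim V"
proof -
  obtain B where B: "B \<subseteq> V" "independent B" "V \<subseteq> span B" "card B = dim V"
    by (rule basis_exists)
  then have "span B = V"
    using assms(1) by (simp add: span_subspace)
  then show ?thesis
    using card_span_independent[of B] B assms(2) by (metis finite_subset)
qed

text \<open>Deleting 0 keeps the span but lowers the number of generators, so a family containing 0
  spans a space of dimension strictly below its size. This is what makes the inverses of the
  generators \<open>a i\<close> genuine.\<close>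

lemma (in vector_space) zero_notin_spanning_image:
  assumes "finite I" and "dim (span (f ` I)) = card I"
  shows "0 \<notin> f ` I"
proof
  assume z: "0 \<in> f ` I"
  have "dim (span (f ` I)) = dim (f ` I - {0})"
    by (metis dim_span span_delete_0)
  also have "\<dots> \<le> card (f ` I - {0})"
    using assms(1) by (intro dim_le_card') auto
  also have "\<dots> < card (f ` I)"
    using z assms(1) by (intro card_Diff1_less) auto
  also have "\<dots> \<le> card I"
    using assms(1) by (rule card_image_le)
  finally show False
    using assms(2) by simp
qed

section \<open>Points of the projective line and their affine coordinate\<close>

lemma vector_space_mult: "vector_space ((*) :: 'a::field \<Rightarrow> 'a \<Rightarrow> 'a)"
  by unfold_locales (simp_all add: algebra_simps)

lemma proj_point_eq: "proj_point v = range (\<lambda>c. (c * fst v, c * snd v))"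
proof -
  interpret V: vector_space "(*) :: 'a \<Rightarrow> 'a \<Rightarrow> 'a" by (rule vector_space_mult)
  interpret P: vector_space_prod "(*) :: 'a \<Rightarrow> 'a \<Rightarrow> 'a" "(*) :: 'a \<Rightarrow> 'a \<Rightarrow> 'a" ..
  show ?thesis
    by (simp add: proj_point_def P.p.span_singleton P.scale_def case_prod_beta)
qed

text \<open>The second coordinate of a multiple of \<open>(\<xi>, 1)\<close> is the scalar itself,
  which replaces the search for a scalar by an equation.\<close>

lemma mem_proj_point_affine: "p \<in> proj_point (\<xi>, 1) \<longleftrightarrow> fst p = snd p * \<xi>"
  by (cases p) (auto simp: proj_point_eq)

lemma proj_point_eq_affine:
  assumes "y \<noteq> 0"
  shows "proj_point (x, y) = proj_point (x / y, 1)"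
proof (rule set_eqI)
  fix p
  show "p \<in> proj_point (x, y) \<longleftrightarrow> p \<in> proj_point (x / y, 1)"
    unfolding mem_proj_point_affine
    using assms
    by (cases p) (auto simp: proj_point_eq field_simps intro!: image_eqI[of _ _ "snd p / y"])
qed

lemma proj_point_eq_infinity:
  assumes "x \<noteq> 0"
  shows "proj_point (x, 0) = proj_point (1, 0)"
proof -
  \<comment> \<open>Stated for every nonzero \<open>x\<close> so that it describes both sides of the
    goal as the same line.\<close>
  have "p \<in> proj_point (x, 0) \<longleftrightarrow> snd p = 0" if "x \<noteq> 0" for x :: 'a and p
    using that by (cases p) (auto simp: proj_point_eq intro!: image_eqI[of _ _ "fst p / x"])
  then show ?thesis
    using assms by auto
qed

lemma inj_proj_point_affine: "inj (\<lambda>\<xi>. proj_point (\<xi>, 1))"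
proof (rule injI)
  fix \<xi> \<eta> :: 'a
  assume "proj_point (\<xi>, 1) = proj_point (\<eta>, 1)"
  then have "(\<xi>, 1) \<in> proj_point (\<eta>, 1)"
    by (metis mem_proj_point_affine fst_conv snd_conv mult_1)
  then show "\<xi> = \<eta>"
    by (simp add: mem_proj_point_affine)
qed

lemma affine_ne_infinity: "proj_point (\<xi>, 1) \<noteq> proj_point (1, 0)"
proof
  assume "proj_point (\<xi>, 1) = proj_point (1, 0)"
  moreover have "(1, 0) \<in> proj_point (1, 0)"
    by (auto simp: proj_point_eq intro: image_eqI[of _ _ 1])
  ultimately have "(1, 0) \<in> proj_point (\<xi>, 1)"
    by simp
  then show False
    by (simp add: mem_proj_point_affine)
qed

text \<open>Vectors with second coordinate 0 all give the excluded point. Any other vector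
  \<open>(x, y)\<close> can be normalised by \<open>y\<close>, with \<open>\<xi> = x / y\<close> and
  \<open>t = y\<close>.\<close>

lemma linear_set_affine_eq:
  "{P \<in> linear_set U. P \<noteq> proj_point (1, 0)}
     = {proj_point (\<xi>, 1) | \<xi>. \<exists>t. t \<noteq> 0 \<and> (t * \<xi>, t) \<in> U}"
proof (rule set_eqI, rule iffI)
  fix P
  assume "P \<in> {P \<in> linear_set U. P \<noteq> proj_point (1, 0)}"
  then obtain x y where xy: "(x, y) \<in> U" "(x, y) \<noteq> 0" "P = proj_point (x, y)"
    and ne: "P \<noteq> proj_point (1, 0)"
    by (auto simp: linear_set_def)
  have "y \<noteq> 0"
    using xy ne proj_point_eq_infinity[of x] by (auto simp: zero_prod_def)
  then have "P = proj_point (x / y, 1)" and "y \<noteq> 0 \<and> (y * (x / y), y) \<in> U"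
    using xy proj_point_eq_affine[of y x] by auto
  then show "P \<in> {proj_point (\<xi>, 1) | \<xi>. \<exists>t. t \<noteq> 0 \<and> (t * \<xi>, t) \<in> U}"
    by blast
next
  fix P
  assume "P \<in> {proj_point (\<xi>, 1) | \<xi>. \<exists>t. t \<noteq> 0 \<and> (t * \<xi>, t) \<in> U}"
  then obtain \<xi> t where P: "P = proj_point (\<xi>, 1)" and t: "t \<noteq> 0" "(t * \<xi>, t) \<in> U"
    by blast
  then have "P = proj_point (t * \<xi>, t)"
    using proj_point_eq_affine[of t "t * \<xi>"] by simp
  then show "P \<in> {P \<in> linear_set U. P \<noteq> proj_point (1, 0)}"
    using P t affine_ne_infinity[of \<xi>] unfolding linear_set_def
    by (auto simp: zero_prod_def)
qed

section \<open>Weights of affine points\<close>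

context field_embedding
begin

lemma base_scale2_eq: "base_scale2 emb c p = (emb c * fst p, emb c * snd p)"
proof -
  interpret vector_space "base_scale emb" by (rule vector_space_base_scale)
  interpret vector_space_prod "base_scale emb" "base_scale emb" ..
  show ?thesis
    by (simp add: base_scale2_def scale_def base_scale_def case_prod_beta)
qed

lemma subspace_mult_vimage:
  assumes "module.subspace (base_scale emb) S"
  shows "module.subspace (base_scale emb) {x. x * \<xi> \<in> S}"
proof -
  interpret vector_space "base_scale emb" by (rule vector_space_base_scale)
  show ?thesis
    using assms by (auto simp: subspace_def base_scale_def distrib_right mult.assoc)
qed

text \<open>The intersection is the image of the subspace of all \<open>t\<close> in
  \<open>T\<close> with \<open>t * \<xi>\<close> in \<open>S\<close> under the map
  \<open>t \<mapsto> (t * \<xi>, t)\<close>, which is linear over the small field.\<close>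

lemma subspace_Times_Int_affine:
  assumes S: "module.subspace (base_scale emb) S" and T: "module.subspace (base_scale emb) T"
  shows "module.subspace (base_scale2 emb) (S \<times> T \<inter> proj_point (\<xi>, 1))"
proof -
  interpret V: vector_space "base_scale emb" by (rule vector_space_base_scale)
  interpret W: vector_space "base_scale2 emb" by (rule vector_space_base_scale2)
  let ?C = "{x. x * \<xi> \<in> S}"
  have eq: "S \<times> T \<inter> proj_point (\<xi>, 1) = (\<lambda>t. (t * \<xi>, t)) ` (?C \<inter> T)"
    by (auto simp: mem_proj_point_affine)
  have *: "Vector_Spaces.linear (base_scale emb) (base_scale2 emb) (\<lambda>t. (t * \<xi>, t))"
    by unfold_locales (simp_all add: base_scale2_eq base_scale_def algebra_simps)
  interpret f: Vector_Spaces.linear "base_scale emb" "base_scale2 emb" "\<lambda>t. (t * \<xi>, t)"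
    by (rule *)
  show ?thesis
    unfolding eq
    by (intro f.subspace_image V.subspace_inter subspace_mult_vimage S T)
qed

text \<open>The same parametrisation is injective, since \<open>t\<close> is the second
  coordinate.\<close>

lemma card_Times_Int_affine:
  "card (S \<times> T \<inter> proj_point (\<xi>, 1)) = card {t \<in> T. t * \<xi> \<in> S}"
proof -
  have "S \<times> T \<inter> proj_point (\<xi>, 1) = (\<lambda>t. (t * \<xi>, t)) ` {t \<in> T. t * \<xi> \<in> S}"
    by (auto simp: mem_proj_point_affine)
  then show ?thesis
    by (simp add: card_image inj_on_def)
qed

end

lemma weight_affine_eq_dim_iff:
  fixes emb :: "'k::{field,finite} \<Rightarrow> 'a::{field,finite}"
  assumes "field_embedding emb"
    and S: "module.subspace (base_scale emb) S" and T: "module.subspace (base_scale emb) T"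
  shows "weight emb (S \<times> T) (proj_point (\<xi>, 1)) = vector_space.dim (base_scale emb) T
           \<longleftrightarrow> (\<forall>t\<in>T. t * \<xi> \<in> S)"
proof -
  interpret field_embedding emb by fact
  interpret V: vector_space "base_scale emb" by (rule vector_space_base_scale)
  interpret W: vector_space "base_scale2 emb" by (rule vector_space_base_scale2)
  let ?X = "S \<times> T \<inter> proj_point (\<xi>, 1)"
  \<comment> \<open>A field has at least two elements, so its order exceeds 1 and equal powers of it
    have equal exponents.\<close>
  have "card {0, 1 :: 'k} \<le> CARD('k)"
    by (rule card_mono) auto
  then have q: "CARD('k) > 1"
    by simp
  have "W.dim ?X = V.dim T \<longleftrightarrow> CARD('k) ^ W.dim ?X = CARD('k) ^ V.dim T"
    using q by (simp add: power_inject_exp)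
  also have "\<dots> \<longleftrightarrow> card ?X = card T"
    using W.card_subspace[OF subspace_Times_Int_affine[OF S T]] V.card_subspace[OF T] by simp
  also have "\<dots> \<longleftrightarrow> card {t \<in> T. t * \<xi> \<in> S} = card T"
    by (simp add: card_Times_Int_affine)
  \<comment> \<open>A subset of a finite set with as many elements is the whole set.\<close>
  also have "\<dots> \<longleftrightarrow> {t \<in> T. t * \<xi> \<in> S} = T"
    using card_subset_eq[of T "{t \<in> T. t * \<xi> \<in> S}"] by auto
  finally show ?thesis
    by (auto simp: weight_def)
qed

theorem theorem3p4:
  fixes emb :: "'k::{field,finite} \<Rightarrow> 'a::{field,finite}"
    and q n r k :: nat
    and S T :: "'a set"
    and U :: "('a \<times> 'a) set"
    and a :: "nat \<Rightarrow> 'a"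
  assumes "primepow q" and "n > 0"
    and "field_embedding emb"
    and "CARD('k) = q" and "CARD('a) = q ^ n"
    and "r > 0" and "k > 0" and "r \<le> k - r"
    and "module.subspace (base_scale emb) S"
    and "vector_space.dim (base_scale emb) S = k - r"
    and "module.subspace (base_scale emb) T"
    and "vector_space.dim (base_scale emb) T = r"
    and "T = module.span (base_scale emb) (a ` {1..r})"
    and "U = S \<times> T"
  shows "{P \<in> linear_set U. weight emb U P = r \<and> P \<noteq> proj_point (1, 0)}
           = {proj_point (\<xi>, 1) | \<xi>. \<xi> \<in> (\<Inter>i\<in>{1..r}. (*) (inverse (a i)) ` S)}
       \<and> card {P \<in> linear_set U. weight emb U P = r \<and> P \<noteq> proj_point (1, 0)}
           = q ^ vector_space.dim (base_scale emb) (\<Inter>i\<in>{1..r}. (*) (inverse (a i)) ` S)"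
proof -
  interpret field_embedding emb by fact
  interpret V: vector_space "base_scale emb" by (rule vector_space_base_scale)
  let ?I = "\<Inter>i\<in>{1..r}. (*) (inverse (a i)) ` S"
  let ?L = "{P \<in> linear_set U. weight emb U P = r \<and> P \<noteq> proj_point (1, 0)}"
  \<comment> \<open>The \<open>r\<close> vectors \<open>a i\<close> span a space of dimension
    \<open>r\<close>.\<close>
  have "0 \<notin> a ` {1..r}"
    using assms by (intro V.zero_notin_spanning_image) auto
  then have nz: "a i \<noteq> 0" if "i \<in> {1..r}" for i
    using that by (metis imageI)
  \<comment> \<open>Nonzero \<open>a i\<close> matter here: as \<open>inverse 0 = 0\<close>, a zero
    generator would shrink the scaled copy of \<open>S\<close> to \<open>{0}\<close>, while the
    condition on the right would hold for every \<open>\<xi>\<close>.\<close>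
  have mem_I: "\<xi> \<in> ?I \<longleftrightarrow> (\<forall>i\<in>{1..r}. a i * \<xi> \<in> S)" for \<xi>
  proof -
    have "\<xi> \<in> (*) (inverse (a i)) ` S \<longleftrightarrow> a i * \<xi> \<in> S" if "i \<in> {1..r}" for i
      using nz[OF that] by (auto simp: mult.assoc[symmetric] intro!: image_eqI[of _ _ "a i * \<xi>"])
    then show ?thesis
      by blast
  qed
  have I: "(\<forall>t\<in>T. t * \<xi> \<in> S) \<longleftrightarrow> \<xi> \<in> ?I" for \<xi>
  proof
    assume "\<forall>t\<in>T. t * \<xi> \<in> S"
    then show "\<xi> \<in> ?I"
      unfolding mem_I \<open>T = _\<close> by (auto intro: V.span_base)
  next
    assume "\<xi> \<in> ?I"
    \<comment> \<open>The right-hand side is a subspace, so containing the generators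
      \<open>a i\<close> is enough for it to contain their span.\<close>
    then have "T \<subseteq> {x. x * \<xi> \<in> S}"
      unfolding mem_I \<open>T = _\<close>
      by (intro V.span_minimal subspace_mult_vimage assms) auto
    then show "\<forall>t\<in>T. t * \<xi> \<in> S"
      by blast
  qed
  \<comment> \<open>For \<open>\<xi>\<close> in \<open>?I\<close> the vector
    \<open>(a 1 * \<xi>, a 1)\<close> lies in \<open>U\<close> and is nonzero, so the point really
    belongs to the linear set. The index 1 exists because \<open>r > 0\<close>.\<close>
  have a1: "a 1 \<noteq> 0" "a 1 \<in> T"
    using nz[of 1] \<open>r > 0\<close> unfolding \<open>T = _\<close> by (auto intro: V.span_base)
  have weight_iff: "weight emb U (proj_point (\<xi>, 1)) = r \<longleftrightarrow> \<xi> \<in> ?I" for \<xi>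
    using weight_affine_eq_dim_iff[of emb S T \<xi>] assms I by simp
  have "?L = {P \<in> {P \<in> linear_set U. P \<noteq> proj_point (1, 0)}. weight emb U P = r}"
    by blast
  also have "\<dots> = {proj_point (\<xi>, 1) | \<xi>. (\<exists>t. t \<noteq> 0 \<and> (t * \<xi>, t) \<in> U) \<and> \<xi> \<in> ?I}"
    unfolding linear_set_affine_eq using weight_iff by blast
  also have "\<dots> = {proj_point (\<xi>, 1) | \<xi>. \<xi> \<in> ?I}"
    using a1 I unfolding \<open>U = _\<close> by blast
  finally have L: "?L = {proj_point (\<xi>, 1) | \<xi>. \<xi> \<in> ?I}" .
  \<comment> \<open>Written as an intersection of preimages of \<open>S\<close> under multiplication
    by \<open>a i\<close>, \<open>?I\<close> is visibly a subspace, so its size is a power of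
    \<open>q\<close>.\<close>
  have "?I = (\<Inter>i\<in>{1..r}. {\<xi>. \<xi> * a i \<in> S})"
    using mem_I by (auto simp: mult.commute)
  then have "V.subspace ?I"
    using subspace_mult_vimage[OF assms(9)] by (auto intro!: V.subspace_Int)
  then have "card ?I = q ^ V.dim ?I"
    using V.card_subspace assms by simp
  \<comment> \<open>Distinct \<open>\<xi>\<close> give distinct points.\<close>
  moreover have "card ?L = card ?I"
    unfolding L Setcompr_eq_image
    by (intro card_image inj_on_subset[OF inj_proj_point_affine]) simp
  ultimately show ?thesis
    using L by simp
qed

end
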